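(* For every integer $r\geq2$, $$W_r(n)\sim\frac{A_r}{n^r},\qquad n\to\infty,\qquad\text{where } A_r:=\sum_{m=0}^\infty W_r(m).$$
   Context: The cycle structure of a permutation of $n$ letters is the partition $\lambda=(\lambda_1,\dots,\lambda_n)$ of $n$ (nonnegative integers with $\sum_j j\lambda_j=n$) where $\lambda_j$ is the number of cycles of length $j$. $W_r(n)$ is the probability that $r$ uniformly random independent permutations of $n$ letters have the same cycle structure, for $n\geq1$; $W_r(0):=1$. *)

theory Defs
  imports
    "HOL-Combinatorics.Orbits"
    "HOL-Probability.Product_PMF"
    "HOL-Library.Landau_Symbols"
begin

text \<open>
  A cycle of \<open>p\<close> is identified with the orbit it permutes; a fixed point is a cycle of length 1.
  The list is \<open>(\<lambda>\<^sub>1, \<dots>, \<lambda>\<^sub>n)\<close>, so \<open>\<lambda>\<^sub>j\<close> is at list position \<open>j - 1\<close>.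
\<close>
definition cycle_structure :: "nat \<Rightarrow> (nat \<Rightarrow> nat) \<Rightarrow> nat list" where
  "cycle_structure n p =
     map (\<lambda>j. card {C \<in> orbit p ` {1..n}. card C = j}) [1..<Suc n]"

definition random_perms :: "nat \<Rightarrow> nat \<Rightarrow> (nat \<Rightarrow> nat \<Rightarrow> nat) pmf" where
  "random_perms r n = Pi_pmf {..<r} id (\<lambda>_. pmf_of_set {p. p permutes {1..n}})"

definition W :: "nat \<Rightarrow> nat \<Rightarrow> real" where
  "W r n = (if n = 0 then 1 else
     measure_pmf.prob (random_perms r n)
       {\<sigma>. \<forall>i<r. \<forall>k<r. cycle_structure n (\<sigma> i) = cycle_structure n (\<sigma> k)})"

end

theory Submission
  imports Defs "HOL-Real_Asymp.Real_Asymp"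
begin

text \<open>
  By Cauchy's formula, \<open>W\<^sub>r(n)\<close> is the sum of \<open>w(\<lambda>)\<^sup>r\<close> over the partitions \<open>\<lambda>\<close> of \<open>n\<close>, where
  \<open>w(\<lambda>) = \<Prod>\<^sub>j 1 / (j ^ \<lambda>\<^sub>j \<lambda>\<^sub>j!)\<close>. Writing \<open>n = \<Sum>\<^sub>j j \<lambda>\<^sub>j\<close> and removing one part \<open>j = n - m\<close> gives
  \<open>n W\<^sub>r(n) = \<Sum>\<^sub>m b(n - m, m) / (n - m) ^ (r - 1)\<close> over \<open>m < n\<close>, where \<open>0 \<le> b(j, m) \<le> W\<^sub>r(m)\<close>, with
  equality on the right when \<open>j > m\<close>. This recurrence alone forces the asymptotics. Summing
  \<open>W\<^sub>r(n) \<le> \<Sum>\<^sub>m W\<^sub>r(m) / (n (n - m))\<close> over \<open>n\<close> attaches to \<open>W\<^sub>r(m)\<close> a coefficient that tends to 0 as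
  \<open>m\<close> grows, so \<open>\<Sum>\<^sub>n W\<^sub>r(n)\<close> converges. In \<open>n\<^sup>r W\<^sub>r(n)\<close> the terms with \<open>m < n / 2\<close> tend to \<open>A\<^sub>r\<close>
  by dominated convergence. By induction \<open>n\<^sup>r W\<^sub>r(n)\<close> is bounded, whence the terms with \<open>m \<ge> n / 2\<close>
  are \<open>O(log n / n)\<close>.
\<close>

subsection \<open>Inserting a point into a cycle\<close>

lemma orbit_subset_closed:
  assumes "f ` A \<subseteq> A" "x \<in> A"
  shows "orbit f x \<subseteq> A"
proof
  fix y assume "y \<in> orbit f x"
  then show "y \<in> A" by induction (use assms in auto)
qed

lemma orbit_eq_iff:
  assumes "permutation f"
  shows "orbit f x = orbit f y \<longleftrightarrow> x \<in> orbit f y"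
  using orbit_cyclic_eq3[OF cyclic_on_orbit'[OF assms]] permutation_self_in_orbit[OF assms] by blast

lemma orbit_transpose_comp:
  assumes q: "permutation q" and fix_a: "q a = a" and "a \<noteq> b"
  shows "orbit (Transposition.transpose a b \<circ> q) b = insert a (orbit q b)"
    (is "orbit ?p b = _")
proof
  have "permutation ?p" using q by (intro permutation_compose permutation_swap_id)
  then have self: "x \<in> orbit ?p x" for x by (rule permutation_self_in_orbit)
  have q_closed: "q y \<in> orbit q b" if "y \<in> orbit q b" for y using that by (rule orbit.step)
  have b: "b \<in> orbit q b" by (rule permutation_self_in_orbit[OF q])
  have "?p y \<in> insert a (orbit q b)" if "y \<in> insert a (orbit q b)" for y
    using that fix_a b q_closed[of y] by (auto simp: Transposition.transpose_def)
  then show "orbit ?p b \<subseteq> insert a (orbit q b)" using b by (intro orbit_subset_closed) blast+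
  have "q y \<in> orbit ?p b - {a}" if y: "y \<in> orbit ?p b - {a}" for y
  proof -
    have "inj q" by (rule bij_is_inj[OF permutation_bijective[OF q]])
    then have "q y \<noteq> a" using y fix_a inj_eq[of q y a] by auto
    moreover have "?p y \<in> orbit ?p b" using y by (blast intro: orbit.step)
    ultimately show ?thesis using self[of b]
      by (cases "q y = b") (simp_all add: Transposition.transpose_def)
  qed
  then have "orbit q b \<subseteq> orbit ?p b - {a}"
    using self[of b] \<open>a \<noteq> b\<close> by (intro orbit_subset_closed) auto
  moreover have "a \<in> orbit ?p b"
    using self[of a] permutation_orbit_step[OF \<open>permutation ?p\<close>, of a] fix_a by simp
  ultimately show "insert a (orbit q b) \<subseteq> orbit ?p b" by blast
qed

lemma orbit_transpose_comp_other:
  assumes q: "permutation q" and "q a = a" and x: "x \<noteq> a" "x \<notin> orbit q b"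
  shows "orbit (Transposition.transpose a b \<circ> q) x = orbit q x"
proof (rule orbit_cong)
  show "x \<in> orbit q x" by (rule permutation_self_in_orbit[OF q])
  fix y assume "y \<in> orbit q x"
  then have qy: "q y \<in> orbit q x" by (rule orbit.step)
  have "a \<notin> orbit q x" "b \<notin> orbit q x"
    using x \<open>q a = a\<close> orbit_eq_iff[OF q, of a x] orbit_eq_iff[OF q, of b x] orbit_eq_iff[OF q, of x]
    by (auto simp flip: orbit_eq_singleton_iff)
  with qy have "q y \<noteq> a" "q y \<noteq> b" by auto
  then show "(Transposition.transpose a b \<circ> q) y = q y" by simp
qed

definition cycle_type :: "'a set \<Rightarrow> ('a \<Rightarrow> 'a) \<Rightarrow> nat multiset" where
  "cycle_type S p = image_mset card (mset_set (orbit p ` S))"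

lemma cycle_type_empty [simp]: "cycle_type {} p = {#}"
  by (simp add: cycle_type_def)

lemma orbits_transpose_comp:
  assumes q: "q permutes S" and S: "finite S" and a: "a \<notin> S" and b: "b \<in> S"
  shows "orbit (Transposition.transpose a b \<circ> q) ` insert a S =
           insert (insert a (orbit q b)) (orbit q ` S - {orbit q b})"
proof -
  let ?p = "Transposition.transpose a b \<circ> q"
  have permq: "permutation q" using q S by (auto simp: permutation_permutes)
  then have permp: "permutation ?p" by (intro permutation_compose permutation_swap_id)
  have qa: "q a = a" and ab: "a \<noteq> b" using permutes_not_in[OF q a] a b by auto
  have sub: "orbit q b \<subseteq> S" by (rule permutes_orbit_subset[OF q b])
  have cycle: "orbit ?p x = insert a (orbit q b)" if "x \<in> insert a (orbit q b)" for x
    using that orbit_eq_iff[OF permp, of x b] orbit_transpose_comp[OF permq qa ab] by simp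
  have other: "orbit ?p x = orbit q x" if "x \<in> S - orbit q b" for x
    using that a by (intro orbit_transpose_comp_other[OF permq qa]) auto
  have "insert a S = insert a (orbit q b) \<union> (S - orbit q b)" using sub by auto
  then have "orbit ?p ` insert a S = orbit ?p ` insert a (orbit q b) \<union> orbit ?p ` (S - orbit q b)"
    by (metis image_Un)
  also have "orbit ?p ` insert a (orbit q b) = {insert a (orbit q b)}"
    using cycle by (auto simp del: o_apply)
  also have "orbit ?p ` (S - orbit q b) = orbit q ` (S - orbit q b)"
    using other by (rule image_cong[OF refl])
  also have "\<dots> = orbit q ` S - {orbit q b}" using orbit_eq_iff[OF permq] by blast
  finally show ?thesis by (simp only: Un_insert_left Un_empty_left)
qed

lemma cycle_type_transpose_comp:
  assumes q: "q permutes S" and S: "finite S" and a: "a \<notin> S" and b: "b \<in> S"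
  shows "cycle_type (insert a S) (Transposition.transpose a b \<circ> q) =
           add_mset (Suc (card (orbit q b))) (cycle_type S q - {#card (orbit q b)#})"
proof -
  have sub: "orbit q x \<subseteq> S" if "x \<in> S" for x by (rule permutes_orbit_subset[OF q that])
  then have "a \<notin> orbit q b" "finite (orbit q b)" using a b S finite_subset by blast+
  moreover have "insert a (orbit q b) \<notin> orbit q ` S - {orbit q b}" using sub a by auto
  ultimately show ?thesis unfolding cycle_type_def orbits_transpose_comp[OF assms]
    using S b by (simp add: mset_set_Diff image_mset_Diff)
qed

lemma cycle_type_insert_fixpoint:
  assumes q: "q permutes S" and S: "finite S" and a: "a \<notin> S"
  shows "cycle_type (insert a S) q = add_mset 1 (cycle_type S q)"
proof -
  have "orbit q a = {a}" using permutes_not_in[OF q a] by (simp add: orbit_eq_singleton_iff)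
  moreover have "{a} \<notin> orbit q ` S" using permutes_orbit_subset[OF q] a by fastforce
  ultimately show ?thesis using S by (simp add: cycle_type_def)
qed

lemma sum_card_orbit:
  fixes g :: "nat \<Rightarrow> 'b::semiring_1"
  assumes q: "q permutes S" and S: "finite S"
  shows "(\<Sum>b\<in>S. g (card (orbit q b))) = (\<Sum>j\<in>#cycle_type S q. of_nat j * g j)"
proof -
  have permq: "permutation q" using q S by (auto simp: permutation_permutes)
  have fibre: "{b\<in>S. orbit q b = C} = C" if orbit: "C \<in> orbit q ` S" for C
  proof -
    obtain x where "x \<in> S" and C: "C = orbit q x" using orbit by blast
    then have "orbit q x \<subseteq> S" by (intro permutes_orbit_subset[OF q])
    then show ?thesis unfolding C orbit_eq_iff[OF permq] by blast
  qed
  have "(\<Sum>b\<in>S. g (card (orbit q b))) =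
          (\<Sum>C\<in>orbit q ` S. \<Sum>b\<in>{b\<in>S. orbit q b = C}. g (card (orbit q b)))"
    by (rule sum.image_gen[OF S])
  also have "\<dots> = (\<Sum>C\<in>orbit q ` S. \<Sum>b\<in>{b\<in>S. orbit q b = C}. g (card C))"
    by (intro sum.cong) auto
  also have "\<dots> = (\<Sum>C\<in>orbit q ` S. of_nat (card C) * g (card C))"
    by (intro sum.cong refl) (simp add: fibre)
  finally show ?thesis
    by (simp add: cycle_type_def sum_unfold_sum_mset image_mset.compositionality o_def)
qed

lemma sum_permutes_insert_cycle_type:
  fixes g :: "nat multiset \<Rightarrow> 'b::semiring_1"
  assumes S: "finite S" and a: "a \<notin> S"
  shows "(\<Sum>p | p permutes insert a S. g (cycle_type (insert a S) p)) =
    (\<Sum>q | q permutes S. g (add_mset 1 (cycle_type S q)) +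
       (\<Sum>j\<in>#cycle_type S q. of_nat j * g (add_mset (Suc j) (cycle_type S q - {#j#}))))"
proof -
  have "(\<Sum>p | p permutes insert a S. g (cycle_type (insert a S) p)) =
      (\<Sum>q | q permutes S. \<Sum>b\<in>insert a S.
         g (cycle_type (insert a S) (Transposition.transpose a b \<circ> q)))"
    unfolding sum_over_permutations_insert[OF assms] by (rule sum.swap)
  also have "\<dots> = (\<Sum>q | q permutes S. g (add_mset 1 (cycle_type S q)) +
       (\<Sum>b\<in>S. g (add_mset (Suc (card (orbit q b))) (cycle_type S q - {#card (orbit q b)#}))))"
    using assms by (simp add: cycle_type_insert_fixpoint cycle_type_transpose_comp)
  also have "\<dots> = (\<Sum>q | q permutes S. g (add_mset 1 (cycle_type S q)) +
       (\<Sum>j\<in>#cycle_type S q. of_nat j * g (add_mset (Suc j) (cycle_type S q - {#j#}))))"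
    by (intro sum.cong refl arg_cong2[of _ _ _ _ "(+)"] sum_card_orbit S) auto
  finally show ?thesis .
qed

subsection \<open>Partitions and Cauchy's formula\<close>

definition partitions_of :: "nat \<Rightarrow> nat multiset set" where
  "partitions_of n = {M. 0 \<notin># M \<and> sum_mset M = n}"

lemma partitions_of_0 [simp]: "partitions_of 0 = {{#}}"
proof -
  have "M = {#}" if "M \<in> partitions_of 0" for M
    using that by (cases M) (auto simp: partitions_of_def)
  then show ?thesis by (auto simp: partitions_of_def)
qed

lemma set_mset_partitions_of: "M \<in> partitions_of n \<Longrightarrow> set_mset M \<subseteq> {1..n}"
  by (auto simp: partitions_of_def Suc_le_eq sum_mset.remove intro: gr0I)

lemma finite_partitions_of [simp]: "finite (partitions_of n)"
proof (rule finite_subset)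
  have "size M \<le> sum_mset M" if "0 \<notin># M" for M :: "nat multiset"
    using that by (induction M) auto
  then show "partitions_of n \<subseteq> (\<Union>k\<in>{..n}. multisets_of_size {1..n} k)"
    using set_mset_partitions_of by (force simp: multisets_of_size_def partitions_of_def)
qed (auto intro!: finite_multisets_of_size)

lemma bij_betw_partitions_of_add_part:
  "bij_betw (\<lambda>(m, K). (add_mset (n - m) K, n - m))
     (SIGMA m:{..<n}. partitions_of m) (SIGMA M:partitions_of n. set_mset M)"
proof (rule bij_betw_byWitness[where f' = "\<lambda>(M, j). (n - j, M - {#j#})"])
  have remove: "sum_mset (M - {#j#}) = n - j \<and> 0 < j \<and> j \<le> n"
    if "M \<in> partitions_of n" "j \<in># M" for M j
    using that set_mset_partitions_of[OF that(1)] by (force simp: partitions_of_def sum_mset.remove)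
  then show "(\<lambda>(M, j). (n - j, M - {#j#})) ` (SIGMA M:partitions_of n. set_mset M)
      \<subseteq> (SIGMA m:{..<n}. partitions_of m)"
    by (fastforce simp: partitions_of_def dest: in_diffD)
  show "\<forall>x\<in>SIGMA M:partitions_of n. set_mset M.
      (\<lambda>(m, K). (add_mset (n - m) K, n - m)) ((\<lambda>(M, j). (n - j, M - {#j#})) x) = x"
    using remove by force
qed (auto simp: partitions_of_def)

definition cycle_weight :: "nat multiset \<Rightarrow> real" where
  "cycle_weight M = (\<Prod>j\<in>set_mset M. 1 / (real j ^ count M j * fact (count M j)))"

lemma cycle_weight_nonneg [simp]: "cycle_weight M \<ge> 0"
  unfolding cycle_weight_def by (intro prod_nonneg) auto

lemma cycle_weight_empty [simp]: "cycle_weight {#} = 1"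
  by (simp add: cycle_weight_def)

lemma cycle_weight_superset:
  assumes "finite A" "set_mset M \<subseteq> A"
  shows "cycle_weight M = (\<Prod>j\<in>A. 1 / (real j ^ count M j * fact (count M j)))"
  unfolding cycle_weight_def using assms
  by (intro prod.mono_neutral_left) (auto simp: not_in_iff)

lemma cycle_weight_add_mset:
  "cycle_weight (add_mset j M) = cycle_weight M / (real j * real (Suc (count M j)))"
proof -
  define A where "A = insert j (set_mset M)"
  define factor where "factor M i = 1 / (real i ^ count M i * fact (count M i))" for M i
  have A: "finite A" "j \<in> A" "set_mset M \<subseteq> A" "set_mset (add_mset j M) \<subseteq> A" by (auto simp: A_def)
  have "factor (add_mset j M) j = factor M j / (real j * real (Suc (count M j)))"
    by (simp add: factor_def field_simps)
  moreover have "(\<Prod>i\<in>A - {j}. factor (add_mset j M) i) = (\<Prod>i\<in>A - {j}. factor M i)"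
    by (intro prod.cong) (auto simp: factor_def)
  ultimately have "prod (factor (add_mset j M)) A
      = prod (factor M) A / (real j * real (Suc (count M j)))"
    using A by (simp add: prod.remove[of A j])
  then show ?thesis using A by (simp add: cycle_weight_superset[of A] factor_def)
qed

lemma sum_mset_eq_sum_count:
  fixes f :: "'a \<Rightarrow> 'b::comm_semiring_1"
  shows "(\<Sum>x\<in>#M. f x) = (\<Sum>x\<in>set_mset M. of_nat (count M x) * f x)"
proof (induction M)
  case (add y M)
  let ?A = "insert y (set_mset M)"
  have "(\<Sum>x\<in>?A. of_nat (count (add_mset y M) x) * f x) =
        (\<Sum>x\<in>?A. (if x = y then f x else 0) + of_nat (count M x) * f x)"
    by (intro sum.cong) (auto simp: algebra_simps)
  also have "\<dots> = f y + (\<Sum>x\<in>?A. of_nat (count M x) * f x)"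
    by (simp add: sum.distrib)
  also have "(\<Sum>x\<in>?A. of_nat (count M x) * f x) = (\<Sum>x\<in>set_mset M. of_nat (count M x) * f x)"
    by (intro sum.mono_neutral_right) (auto simp: not_in_iff)
  finally show ?case using add by simp
qed simp

text \<open>The left side marks one of the \<open>n\<close> points, the right side removes the cycle through it.\<close>
lemma sum_cycle_weight_size_biased:
  fixes h :: "nat \<Rightarrow> nat multiset \<Rightarrow> real"
  shows "(\<Sum>M\<in>partitions_of n. cycle_weight M * (\<Sum>j\<in>#M. real j * h j (M - {#j#}))) =
         (\<Sum>m<n. \<Sum>K\<in>partitions_of m. cycle_weight K * h (n - m) K)"
proof -
  define marked where
    "marked = (\<lambda>(M, j). cycle_weight M * (real (count M j) * (real j * h j (M - {#j#}))))"
  have "(\<Sum>M\<in>partitions_of n. cycle_weight M * (\<Sum>j\<in>#M. real j * h j (M - {#j#}))) =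
      sum marked (SIGMA M:partitions_of n. set_mset M)"
    by (simp add: marked_def sum_mset_eq_sum_count sum_distrib_left sum.Sigma)
  also have "\<dots> = (\<Sum>(m, K)\<in>(SIGMA m:{..<n}. partitions_of m). marked (add_mset (n - m) K, n - m))"
    unfolding sum.reindex_bij_betw[OF bij_betw_partitions_of_add_part, symmetric]
    by (simp add: case_prod_unfold)
  also have "\<dots> = (\<Sum>m<n. \<Sum>K\<in>partitions_of m. marked (add_mset (n - m) K, n - m))"
    by (simp add: sum.Sigma)
  also have "\<dots> = (\<Sum>m<n. \<Sum>K\<in>partitions_of m. cycle_weight K * h (n - m) K)"
    by (intro sum.cong refl) (simp add: marked_def cycle_weight_add_mset del: of_nat_Suc)
  finally show ?thesis .
qed

corollary sum_cycle_weight_add_part: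
  fixes g :: "nat multiset \<Rightarrow> real"
  shows "real n * (\<Sum>M\<in>partitions_of n. cycle_weight M * g M) =
         (\<Sum>m<n. \<Sum>K\<in>partitions_of m. cycle_weight K * g (add_mset (n - m) K))"
proof -
  have "(\<Sum>j\<in>#M. real j * g (add_mset j (M - {#j#}))) = real n * g M" if "M \<in> partitions_of n" for M
  proof -
    have "(\<Sum>j\<in>#M. real j * g (add_mset j (M - {#j#}))) = (\<Sum>j\<in>#M. real j * g M)"
      by (intro arg_cong[of _ _ sum_mset] image_mset_cong) simp
    also have "\<dots> = real (sum_mset M) * g M"
      by (simp add: sum_mset_distrib_right)
    also have "sum_mset M = n" using that by (simp add: partitions_of_def)
    finally show ?thesis .
  qed
  then have "real n * (\<Sum>M\<in>partitions_of n. cycle_weight M * g M) =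
      (\<Sum>M\<in>partitions_of n. cycle_weight M * (\<Sum>j\<in>#M. real j * g (add_mset j (M - {#j#}))))"
    by (simp add: sum_distrib_left mult_ac)
  then show ?thesis
    using sum_cycle_weight_size_biased[where n = n and h = "\<lambda>j K. g (add_mset j K)"] by simp
qed

text \<open>Both sides obey the same recursion: inserting the point \<open>a\<close> on the left corresponds to
  growing the marked cycle by one on the right.\<close>
lemma sum_permutes_cycle_type:
  fixes g :: "nat multiset \<Rightarrow> real"
  assumes "finite S"
  shows "(\<Sum>p | p permutes S. g (cycle_type S p)) =
           fact (card S) * (\<Sum>M\<in>partitions_of (card S). cycle_weight M * g M)"
  using assms
proof (induction S arbitrary: g rule: finite_induct)
  case empty
  show ?case by simp
next
  case (insert a S)
  let ?n = "card S"
  define mean where "mean n g = (\<Sum>M\<in>partitions_of n. cycle_weight M * g M)"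
    for n and g :: "nat multiset \<Rightarrow> real"
  have "(\<Sum>p | p permutes insert a S. g (cycle_type (insert a S) p)) =
      (\<Sum>q | q permutes S. g (add_mset 1 (cycle_type S q)) +
         (\<Sum>j\<in>#cycle_type S q. real j * g (add_mset (Suc j) (cycle_type S q - {#j#}))))"
    by (rule sum_permutes_insert_cycle_type[OF insert.hyps])
  also have "\<dots> = fact ?n * mean ?n (\<lambda>M. g (add_mset 1 M) +
      (\<Sum>j\<in>#M. real j * g (add_mset (Suc j) (M - {#j#}))))"
    unfolding mean_def by (rule insert.IH)
  also have "mean ?n (\<lambda>M. g (add_mset 1 M) + (\<Sum>j\<in>#M. real j * g (add_mset (Suc j) (M - {#j#})))) =
      mean ?n (\<lambda>K. g (add_mset 1 K)) + (\<Sum>m<?n. mean m (\<lambda>K. g (add_mset (Suc (?n - m)) K)))"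
    unfolding mean_def
    by (simp add: distrib_left sum.distrib sum_cycle_weight_size_biased
        [where h = "\<lambda>j K. g (add_mset (Suc j) K)"])
  also have "\<dots> = (\<Sum>m<Suc ?n. mean m (\<lambda>K. g (add_mset (Suc ?n - m) K)))"
    by (simp add: Suc_diff_le)
  also have "\<dots> = real (Suc ?n) * mean (Suc ?n) g"
    unfolding mean_def by (rule sum_cycle_weight_add_part[symmetric])
  finally show ?case using insert.hyps by (simp add: mean_def)
qed

subsection \<open>The coincidence probability as a sum over partitions\<close>

lemma prob_cycle_type:
  assumes "finite S" "M \<in> partitions_of (card S)"
  shows "measure_pmf.prob (pmf_of_set {p. p permutes S}) {p. cycle_type S p = M} = cycle_weight M"
proof -
  let ?P = "{p. p permutes S}"
  have P: "finite ?P" "?P \<noteq> {}" using assms(1) by (auto intro: finite_permutations permutes_id)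
  have "real (card (?P \<inter> {p. cycle_type S p = M})) = (\<Sum>p\<in>?P. of_bool (cycle_type S p = M))"
    using P(1) by (simp add: Int_def)
  also have "\<dots> = fact (card S) * cycle_weight M"
    using assms by (simp add: sum_permutes_cycle_type[where g = "\<lambda>N. of_bool (N = M)"])
  finally show ?thesis
    using P assms(1) by (simp add: measure_pmf_of_set card_permutations)
qed

lemma prob_iid_all_equal:
  fixes p :: "'a pmf" and f :: "'a \<Rightarrow> 'b"
  assumes I: "finite I" "I \<noteq> {}" and Y: "finite Y" "f ` set_pmf p \<subseteq> Y"
  shows "measure_pmf.prob (Pi_pmf I d (\<lambda>_. p)) {\<sigma>. \<forall>i\<in>I. \<forall>k\<in>I. f (\<sigma> i) = f (\<sigma> k)} =
           (\<Sum>y\<in>Y. measure_pmf.prob p (f -` {y}) ^ card I)"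
proof -
  let ?p = "Pi_pmf I d (\<lambda>_. p)"
  let ?E = "{\<sigma>. \<forall>i\<in>I. \<forall>k\<in>I. f (\<sigma> i) = f (\<sigma> k)}"
  define F where "F y = Pi I (\<lambda>_. f -` {y})" for y
  obtain i0 where i0: "i0 \<in> I" using I by blast
  have on_support: "?E \<inter> set_pmf ?p = (\<Union>y\<in>Y. F y) \<inter> set_pmf ?p"
  proof (intro equalityI subsetI)
    fix \<sigma> assume \<sigma>: "\<sigma> \<in> ?E \<inter> set_pmf ?p"
    then have "\<sigma> i0 \<in> set_pmf p" using i0 I(1) by (simp add: set_Pi_pmf PiE_dflt_def)
    then have "f (\<sigma> i0) \<in> Y" using Y(2) by blast
    moreover have "f (\<sigma> i) = f (\<sigma> i0)" if "i \<in> I" for i using \<sigma> i0 that by blast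
    then have "\<sigma> \<in> F (f (\<sigma> i0))" by (simp add: F_def Pi_iff)
    ultimately show "\<sigma> \<in> (\<Union>y\<in>Y. F y) \<inter> set_pmf ?p" using \<sigma> by blast
  qed (auto simp: F_def Pi_iff)
  have "measure_pmf.prob ?p ?E = measure_pmf.prob ?p ((\<Union>y\<in>Y. F y) \<inter> set_pmf ?p)"
    unfolding on_support[symmetric] by (rule measure_Int_set_pmf[symmetric])
  also have "\<dots> = measure_pmf.prob ?p (\<Union>y\<in>Y. F y)" by (rule measure_Int_set_pmf)
  also have "\<dots> = (\<Sum>y\<in>Y. measure_pmf.prob ?p (F y))"
  proof (rule measure_pmf.finite_measure_finite_Union[OF Y(1)])
    have "f (\<sigma> i0) = y" if "\<sigma> \<in> F y" for \<sigma> y using that i0 by (auto simp: F_def)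
    then show "disjoint_family_on F Y" unfolding disjoint_family_on_def by blast
  qed auto
  also have "\<dots> = (\<Sum>y\<in>Y. measure_pmf.prob p (f -` {y}) ^ card I)"
    using I by (simp add: F_def measure_Pi_pmf_Pi)
  finally show ?thesis .
qed

lemma cycle_type_in_partitions_of:
  assumes p: "p permutes S" and S: "finite S"
  shows "cycle_type S p \<in> partitions_of (card S)"
proof -
  have "card (orbit p x) \<noteq> 0" if "x \<in> S" for x
    using finite_subset[OF permutes_orbit_subset[OF p that] S] orbit_nonempty[of p x] by simp
  then have "0 \<notin># cycle_type S p" using S by (force simp: cycle_type_def)
  then show ?thesis using sum_card_orbit[OF p S, of "\<lambda>_. 1 :: nat"] by (simp add: partitions_of_def)
qed

definition part_counts :: "nat \<Rightarrow> nat multiset \<Rightarrow> nat list" where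
  "part_counts n M = map (count M) [1..<Suc n]"

lemma cycle_structure_eq_part_counts:
  "cycle_structure n p = part_counts n (cycle_type {1..n} p)"
  unfolding cycle_structure_def cycle_type_def part_counts_def
  by (intro map_cong refl) (simp add: count_image_mset_eq_card_vimage)

lemma inj_on_part_counts: "inj_on (part_counts n) (partitions_of n)"
proof (intro inj_onI multiset_eqI)
  fix M N j
  assume MN: "M \<in> partitions_of n" "N \<in> partitions_of n" "part_counts n M = part_counts n N"
  show "count M j = count N j"
  proof (cases "j \<in> {1..n}")
    case True
    then show ?thesis using MN(3) by (simp add: part_counts_def del: upt_Suc)
  next
    case False
    then have "j \<notin># M" "j \<notin># N" using MN(1,2)[THEN set_mset_partitions_of] by blast+
    then show ?thesis by (simp add: not_in_iff)
  qed
qed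

lemma W_eq_sum_cycle_weight_power:
  assumes r: "r > 0"
  shows "W r n = (\<Sum>M\<in>partitions_of n. cycle_weight M ^ r)"
proof (cases "n = 0")
  case True
  then show ?thesis by (simp add: W_def)
next
  case False
  define unif where "unif = pmf_of_set {p. p permutes {1..n}}"
  have "finite {p. p permutes {1..n}}" "{p. p permutes {1..n}} \<noteq> {}"
    by (auto intro: finite_permutations permutes_id)
  then have set_unif: "set_pmf unif = {p. p permutes {1..n}}" by (simp add: unif_def)
  have type: "cycle_type {1..n} p \<in> partitions_of n" if "p permutes {1..n}" for p
    using cycle_type_in_partitions_of[OF that] by simp
  have prob: "measure_pmf.prob unif (cycle_structure n -` {part_counts n M}) = cycle_weight M"
    if M: "M \<in> partitions_of n" for M
  proof -
    have "cycle_structure n -` {part_counts n M} \<inter> set_pmf unif =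
        {p. cycle_type {1..n} p = M} \<inter> set_pmf unif"
      using type M
      by (auto simp: set_unif cycle_structure_eq_part_counts inj_on_eq_iff[OF inj_on_part_counts])
    then have "measure_pmf.prob unif (cycle_structure n -` {part_counts n M}) =
        measure_pmf.prob unif {p. cycle_type {1..n} p = M}"
      by (metis measure_Int_set_pmf)
    then show ?thesis using M prob_cycle_type[of "{1..n}" M] by (simp add: unif_def)
  qed
  have "W r n = measure_pmf.prob (Pi_pmf {..<r} id (\<lambda>_. unif))
      {\<sigma>. \<forall>i\<in>{..<r}. \<forall>k\<in>{..<r}. cycle_structure n (\<sigma> i) = cycle_structure n (\<sigma> k)}"
    using False by (simp add: W_def random_perms_def unif_def Ball_def)
  also have "\<dots> = (\<Sum>y\<in>part_counts n ` partitions_of n.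
      measure_pmf.prob unif (cycle_structure n -` {y}) ^ card {..<r})"
    using r type by (intro prob_iid_all_equal) (auto simp: set_unif cycle_structure_eq_part_counts)
  also have "\<dots> = (\<Sum>M\<in>partitions_of n. cycle_weight M ^ r)"
    by (simp add: sum.reindex[OF inj_on_part_counts] prob)
  finally show ?thesis .
qed

subsection \<open>Size-biased recurrences\<close>

lemma summable_if_partial_sums_le:
  fixes a \<epsilon> :: "nat \<Rightarrow> real"
  assumes a: "\<And>n. a n \<ge> 0" and \<epsilon>: "\<epsilon> \<longlonglongrightarrow> 0"
    and le: "\<And>N. (\<Sum>n\<le>N. a n) \<le> c + (\<Sum>n\<le>N. \<epsilon> n * a n)"
  shows "summable a"
proof -
  from \<epsilon> have "\<forall>\<^sub>F n in sequentially. \<epsilon> n < 1 / 2" by (rule order_tendstoD) simp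
  then obtain N0 where N0: "\<epsilon> n < 1 / 2" if "n \<ge> N0" for n
    unfolding eventually_sequentially by blast
  define d where "d n = (if n < N0 then \<bar>\<epsilon> n\<bar> * a n else 0)" for n
  have "(\<Sum>n\<le>N. a n) \<le> 2 * (c + (\<Sum>n<N0. d n))" for N
  proof -
    have "\<epsilon> n * a n \<le> d n + a n / 2" for n
    proof (cases "n < N0")
      case True
      then show ?thesis using a[of n] mult_right_mono[OF abs_ge_self[of "\<epsilon> n"] a[of n]]
        by (simp add: d_def)
    next
      case False
      then show ?thesis using N0[of n] mult_right_mono[OF _ a[of n], of "\<epsilon> n" "1 / 2"]
        by (simp add: d_def)
    qed
    then have "(\<Sum>n\<le>N. \<epsilon> n * a n) \<le> (\<Sum>n\<le>N. d n) + (\<Sum>n\<le>N. a n) / 2"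
      unfolding sum_divide_distrib sum.distrib[symmetric] by (rule sum_mono)
    moreover have "(\<Sum>n\<le>N. d n) \<le> (\<Sum>n<N0. d n)"
    proof -
      have "(\<Sum>n\<le>N. d n) = (\<Sum>n\<in>{..N} \<inter> {..<N0}. d n)"
        by (rule sum.mono_neutral_right) (auto simp: d_def)
      also have "\<dots> \<le> (\<Sum>n<N0. d n)" by (rule sum_mono2) (auto simp: d_def a)
      finally show ?thesis .
    qed
    ultimately show ?thesis using le[of N] by simp
  qed
  then show ?thesis by (rule bounded_imp_summable[OF a])
qed

lemma summable_inverse_mult_shift: "summable (\<lambda>k. 1 / (real (Suc k) * real (Suc (k + m))))"
proof (rule summable_comparison_test')
  show "summable (\<lambda>k. inverse (real (Suc k) ^ 2))"
    using inverse_power_summable[of 2, where 'a = real] by (subst summable_Suc_iff) auto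
  show "norm (1 / (real (Suc k) * real (Suc (k + m)))) \<le> inverse (real (Suc k) ^ 2)" for k
    by (simp add: divide_simps power2_eq_square mult_left_mono)
qed

definition shifted_inverse_series :: "nat \<Rightarrow> real" where
  "shifted_inverse_series m = (\<Sum>k. 1 / (real (Suc k) * real (Suc (k + m))))"

lemma shifted_inverse_series_nonneg: "0 \<le> shifted_inverse_series m"
  unfolding shifted_inverse_series_def by (intro suminf_nonneg summable_inverse_mult_shift) auto

lemma shifted_inverse_series_tendsto_0: "shifted_inverse_series \<longlonglongrightarrow> 0"
proof -
  have "((\<lambda>m. 1 / (real (Suc k) * real (Suc (k + m)))) \<longlonglongrightarrow> 0)" for k by real_asymp
  moreover have "1 / (real (Suc k) * real (Suc (k + m))) \<le> 1 / (real (Suc k) * real (Suc (k + 0)))"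
    for k m by (intro divide_left_mono mult_left_mono) auto
  ultimately show ?thesis
    using tannerys_theorem[of "\<lambda>k m. 1 / (real (Suc k) * real (Suc (k + m)))" "\<lambda>_. 0" sequentially
        "\<lambda>k. 1 / (real (Suc k) * real (Suc (k + 0)))"]
      summable_inverse_mult_shift[of 0]
    by (simp add: case_prod_unfold shifted_inverse_series_def[abs_def])
qed

lemma sum_inverse_mult_diff_le_shifted_inverse_series:
  "(\<Sum>n=Suc m..N. 1 / (real n * real (n - m))) \<le> shifted_inverse_series m"
proof -
  have "(\<Sum>n=Suc m..N. 1 / (real n * real (n - m))) =
      (\<Sum>k<N - m. 1 / (real (Suc k) * real (Suc (k + m))))"
    by (rule sum.reindex_bij_witness[of _ "\<lambda>k. Suc (k + m)" "\<lambda>n. n - Suc m"])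
      (auto simp: of_nat_diff mult_ac)
  also have "\<dots> \<le> shifted_inverse_series m"
    unfolding shifted_inverse_series_def by (intro sum_le_suminf summable_inverse_mult_shift) auto
  finally show ?thesis .
qed

lemma harm_over_n_tendsto_0: "(\<lambda>n. harm n / real n) \<longlonglongrightarrow> 0"
proof -
  have "(\<lambda>n. (harm n - ln (real n)) * (1 / real n) + ln (real n) / real n)
      \<longlonglongrightarrow> euler_mascheroni * 0 + 0"
    by (intro tendsto_add tendsto_mult euler_mascheroni_LIMSEQ) real_asymp+
  then show ?thesis by (simp add: diff_divide_distrib)
qed

lemma sum_dilated_tendsto_suminf:
  fixes a :: "nat \<Rightarrow> real"
  assumes nonneg: "\<And>m. a m \<ge> 0" and summable: "summable a"
  shows "(\<lambda>n. \<Sum>m | 2 * m < n. a m * (real n / real (n - m)) ^ s) \<longlonglongrightarrow> (\<Sum>m. a m)"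
proof -
  define f where "f m n = (if 2 * m < n then a m * (real n / real (n - m)) ^ s else 0)" for m n
  have lim: "(\<lambda>n. f m n) \<longlonglongrightarrow> a m" for m
  proof (rule Lim_transform_eventually)
    have "(\<lambda>n. real n / (real n - real m)) \<longlonglongrightarrow> 1" by real_asymp
    then have "(\<lambda>n. a m * (real n / (real n - real m)) ^ s) \<longlonglongrightarrow> a m * 1 ^ s"
      by (intro tendsto_intros)
    then show "(\<lambda>n. a m * (real n / (real n - real m)) ^ s) \<longlonglongrightarrow> a m" by simp
    show "\<forall>\<^sub>F n in sequentially. a m * (real n / (real n - real m)) ^ s = f m n"
      using eventually_gt_at_top[of "2 * m"] by eventually_elim (simp add: f_def of_nat_diff)
  qed
  have bound: "norm (f m n) \<le> 2 ^ s * a m" for m n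
  proof (cases "2 * m < n")
    case True
    then have "real n / real (n - m) \<le> 2" by (simp add: field_simps of_nat_diff)
    then have "(real n / real (n - m)) ^ s \<le> 2 ^ s" by (intro power_mono) auto
    then show ?thesis using True nonneg[of m] by (simp add: f_def mult_left_mono mult.commute)
  qed (use nonneg in \<open>simp add: f_def\<close>)
  have "(\<lambda>n. \<Sum>m. f m n) \<longlonglongrightarrow> (\<Sum>m. a m)"
    using tannerys_theorem[of f a sequentially "\<lambda>m. 2 ^ s * a m"] lim bound summable
      summable_mult[OF summable] by (simp add: case_prod_unfold)
  moreover have "(\<Sum>m. f m n) = (\<Sum>m | 2 * m < n. a m * (real n / real (n - m)) ^ s)" for n
  proof -
    have "finite {m. 2 * m < n}" by (rule finite_subset[of _ "{..n}"]) auto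
    then have "(\<Sum>m. f m n) = (\<Sum>m | 2 * m < n. f m n)" by (rule suminf_finite) (auto simp: f_def)
    then show ?thesis by (simp add: f_def)
  qed
  ultimately show ?thesis by simp
qed

lemma divide_power_le_divide:
  assumes "s > 0" "0 \<le> x"
  shows "x / real k ^ s \<le> x / real k"
proof (cases "k = 0")
  case False
  then have "real k \<le> real k ^ s" using assms by (intro self_le_power) auto
  then show ?thesis using assms False by (intro divide_left_mono) auto
qed (use assms in \<open>simp add: zero_power\<close>)

locale size_biased_recurrence =
  fixes s :: nat and a :: "nat \<Rightarrow> real" and b :: "nat \<Rightarrow> nat \<Rightarrow> real"
  assumes s_pos: "s > 0"
    and b_nonneg: "0 \<le> b j m"
    and b_le: "b j m \<le> a m"
    and b_eq: "m < j \<Longrightarrow> b j m = a m"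
    and recurrence: "real n * a n = (\<Sum>m<n. b (n - m) m / real (n - m) ^ s)"
begin

lemma a_nonneg: "0 \<le> a m"
  using b_nonneg b_le by (rule order_trans)

lemma summable_a: "summable a"
proof (rule summable_if_partial_sums_le[OF a_nonneg shifted_inverse_series_tendsto_0])
  fix N
  have "a n \<le> (if n = 0 then a 0 else 0) + (\<Sum>m<n. a m / (real n * real (n - m)))" for n
  proof (cases "n = 0")
    case False
    have "real n * a n \<le> (\<Sum>m<n. a m / real (n - m) ^ s)"
      unfolding recurrence by (intro sum_mono divide_right_mono b_le) auto
    also have "\<dots> \<le> (\<Sum>m<n. a m / real (n - m))"
      by (intro sum_mono divide_power_le_divide s_pos a_nonneg)
    finally have "a n \<le> (\<Sum>m<n. a m / real (n - m)) / real n"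
      using False by (simp add: field_simps)
    then show ?thesis using False by (simp add: sum_divide_distrib mult.commute)
  qed simp
  then have "(\<Sum>n\<le>N. a n) \<le>
      (\<Sum>n\<le>N. (if n = 0 then a 0 else 0) + (\<Sum>m<n. a m / (real n * real (n - m))))"
    by (rule sum_mono)
  also have "\<dots> = a 0 + (\<Sum>n\<le>N. \<Sum>m<n. a m / (real n * real (n - m)))"
    by (simp add: sum.distrib)
  also have "(\<Sum>n\<le>N. \<Sum>m<n. a m / (real n * real (n - m))) =
      (\<Sum>m<N. a m * (\<Sum>n=Suc m..N. 1 / (real n * real (n - m))))"
    by (simp add: sum.nested_swap' sum_distrib_left)
  also have "\<dots> \<le> (\<Sum>m<N. a m * shifted_inverse_series m)"
    by (intro sum_mono mult_left_mono sum_inverse_mult_diff_le_shifted_inverse_series a_nonneg)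
  also have "\<dots> \<le> (\<Sum>m\<le>N. a m * shifted_inverse_series m)"
    by (intro sum_mono2 mult_nonneg_nonneg a_nonneg shifted_inverse_series_nonneg) auto
  finally show "(\<Sum>n\<le>N. a n) \<le> a 0 + (\<Sum>n\<le>N. shifted_inverse_series n * a n)"
    by (simp add: mult.commute)
qed

definition far_sum :: "nat \<Rightarrow> real" where
  "far_sum n = (\<Sum>m | 2 * m < n. a m * (real n / real (n - m)) ^ s)"

definition near_sum :: "nat \<Rightarrow> real" where
  "near_sum n = (\<Sum>m | m < n \<and> n \<le> 2 * m. b (n - m) m * (real n / real (n - m)) ^ s)"

lemma far_sum_tendsto: "far_sum \<longlonglongrightarrow> (\<Sum>m. a m)"
  unfolding far_sum_def[abs_def] by (rule sum_dilated_tendsto_suminf[OF a_nonneg summable_a])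

lemma scaled_eq_far_sum_plus_near_sum: "real n ^ Suc s * a n = far_sum n + near_sum n"
proof -
  let ?t = "\<lambda>m. b (n - m) m * (real n / real (n - m)) ^ s"
  have "real n ^ Suc s * a n = real n ^ s * (real n * a n)" by simp
  also have "\<dots> = sum ?t {..<n}"
    unfolding recurrence by (simp add: sum_distrib_left power_divide mult.commute)
  also have "{..<n} = {m. 2 * m < n} \<union> {m. m < n \<and> n \<le> 2 * m}" by auto
  also have "sum ?t \<dots> = sum ?t {m. 2 * m < n} + near_sum n"
    unfolding near_sum_def by (rule sum.union_disjoint) (auto intro: finite_subset[of _ "{..n}"])
  also have "sum ?t {m. 2 * m < n} = far_sum n"
    unfolding far_sum_def by (intro sum.cong refl) (simp add: b_eq)
  finally show ?thesis .
qed

lemma near_sum_nonneg: "0 \<le> near_sum n"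
  unfolding near_sum_def by (intro sum_nonneg mult_nonneg_nonneg b_nonneg) auto

lemma near_sum_le:
  assumes C: "\<And>m. m < n \<Longrightarrow> real m ^ Suc s * a m \<le> C" and "0 \<le> C"
  shows "near_sum n \<le> 2 ^ Suc s * C * (harm n / real n)"
proof (cases "n = 0")
  case False
  have "b (n - m) m * (real n / real (n - m)) ^ s \<le> 2 ^ Suc s * C / real (n - m) / real n"
    if m: "m < n" "n \<le> 2 * m" for m
  proof -
    have "real n ^ Suc s * b (n - m) m \<le> (2 * real m) ^ Suc s * a m"
      using m b_le b_nonneg by (intro mult_mono power_mono) auto
    also have "\<dots> \<le> 2 ^ Suc s * C" using C[OF m(1)] by (simp add: power_mult_distrib)
    finally have "real n * (b (n - m) m * (real n / real (n - m)) ^ s)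
        \<le> 2 ^ Suc s * C / real (n - m) ^ s"
      by (simp add: power_divide divide_right_mono mult_ac)
    also have "\<dots> \<le> 2 ^ Suc s * C / real (n - m)"
      using \<open>0 \<le> C\<close> by (intro divide_power_le_divide s_pos) auto
    finally show ?thesis
      using False by (simp only: pos_le_divide_eq of_nat_0_less_iff neq0_conv mult.commute)
  qed
  then have "near_sum n \<le> (\<Sum>m | m < n \<and> n \<le> 2 * m. 2 ^ Suc s * C / real (n - m) / real n)"
    unfolding near_sum_def by (intro sum_mono) auto
  also have "\<dots> \<le> (\<Sum>m<n. 2 ^ Suc s * C / real (n - m) / real n)"
    using \<open>0 \<le> C\<close> by (intro sum_mono2) auto
  also have "\<dots> = 2 ^ Suc s * C / real n * (\<Sum>m<n. 1 / real (n - m))"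
    by (simp add: sum_distrib_left sum_divide_distrib mult.commute)
  also have "(\<Sum>m<n. 1 / real (n - m)) = harm n"
    unfolding harm_def by (rule sum.reindex_bij_witness[of _ "\<lambda>k. n - k" "\<lambda>m. n - m"])
      (auto simp: inverse_eq_divide)
  finally show ?thesis by simp
qed (simp add: near_sum_def)

lemma scaled_bounded:
  obtains C where "0 \<le> C" "\<And>n. real n ^ Suc s * a n \<le> C"
proof -
  obtain B where B: "0 < B" "norm (far_sum n) \<le> B" for n
    using convergent_imp_Bseq[OF convergentI[OF far_sum_tendsto]] by (auto elim: BseqE)
  have "(\<lambda>n. 2 ^ Suc s * (harm n / real n)) \<longlonglongrightarrow> 2 ^ Suc s * 0"
    by (intro tendsto_intros harm_over_n_tendsto_0)
  then have "\<forall>\<^sub>F n in sequentially. 2 ^ Suc s * (harm n / real n) < 1 / 2"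
    by (rule order_tendstoD) simp
  then obtain N where N: "2 ^ Suc s * (harm n / real n) < 1 / 2" if "n \<ge> N" for n
    unfolding eventually_sequentially by blast
  define C where "C = 2 * B + (\<Sum>m<N. real m ^ Suc s * a m)"
  have scaled_nonneg: "0 \<le> real m ^ Suc s * a m" for m by (simp add: a_nonneg)
  then have C: "0 \<le> C" "2 * B \<le> C" using B(1) by (simp_all add: C_def sum_nonneg del: power_Suc)
  have "real n ^ Suc s * a n \<le> C" for n
  proof (induction n rule: less_induct)
    case (less n)
    show ?case
    proof (cases "n < N")
      case True
      then have "real n ^ Suc s * a n \<le> (\<Sum>m<N. real m ^ Suc s * a m)"
        using scaled_nonneg by (intro member_le_sum) auto
      then show ?thesis using B(1) by (simp add: C_def)
    next
      case False
      have "near_sum n \<le> 2 ^ Suc s * (harm n / real n) * C"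
        using near_sum_le[OF less.IH C(1)] by (simp add: mult_ac)
      also have "\<dots> \<le> 1 / 2 * C" using N[of n] False C(1) by (intro mult_right_mono) auto
      finally show ?thesis
        using B(2)[of n] C(2) unfolding scaled_eq_far_sum_plus_near_sum by simp
    qed
  qed
  then show ?thesis using that C(1) by blast
qed

lemma near_sum_tendsto_0: "near_sum \<longlonglongrightarrow> 0"
proof -
  obtain C where C: "0 \<le> C" "\<And>n. real n ^ Suc s * a n \<le> C" by (rule scaled_bounded) blast
  show ?thesis
  proof (rule tendsto_sandwich[OF always_eventually always_eventually])
    show "\<forall>n. 0 \<le> near_sum n" by (simp add: near_sum_nonneg)
    show "\<forall>n. near_sum n \<le> 2 ^ Suc s * C * (harm n / real n)" using near_sum_le C by blast
    show "(\<lambda>n. 2 ^ Suc s * C * (harm n / real n)) \<longlonglongrightarrow> 0"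
      by (rule tendsto_mult_right_zero[OF harm_over_n_tendsto_0])
  qed simp
qed

lemma scaled_tendsto: "(\<lambda>n. real n ^ Suc s * a n) \<longlonglongrightarrow> (\<Sum>m. a m)"
  using tendsto_add[OF far_sum_tendsto near_sum_tendsto_0]
  by (simp add: scaled_eq_far_sum_plus_near_sum del: power_Suc)

end

subsection \<open>The recurrence for coincidence probabilities\<close>

definition damped_W :: "nat \<Rightarrow> nat \<Rightarrow> nat \<Rightarrow> real" where
  "damped_W s j m = (\<Sum>K\<in>partitions_of m. cycle_weight K ^ Suc s / real (Suc (count K j)) ^ s)"

lemma size_biased_recurrence_W:
  assumes "s > 0"
  shows "size_biased_recurrence s (W (Suc s)) (damped_W s)"
proof
  have W: "W (Suc s) m = (\<Sum>K\<in>partitions_of m. cycle_weight K ^ Suc s)" for m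
    by (rule W_eq_sum_cycle_weight_power) simp
  show "0 \<le> damped_W s j m" for j m unfolding damped_W_def by (intro sum_nonneg) simp
  show "damped_W s j m \<le> W (Suc s) m" for j m
  proof -
    have "x / real (Suc k) ^ s \<le> x" if "x \<ge> 0" for x :: real and k
      using that by (simp add: divide_le_eq mult_le_cancel_left1 del: of_nat_Suc)
    then show ?thesis unfolding W damped_W_def by (intro sum_mono) simp
  qed
  show "damped_W s j m = W (Suc s) m" if "m < j" for j m
    unfolding W damped_W_def
  proof (intro sum.cong refl)
    fix K assume "K \<in> partitions_of m"
    then have "j \<notin># K" using set_mset_partitions_of[of K m] that by auto
    then show "cycle_weight K ^ Suc s / real (Suc (count K j)) ^ s = cycle_weight K ^ Suc s"
      by (simp add: not_in_iff)
  qed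
  show "real n * W (Suc s) n = (\<Sum>m<n. damped_W s (n - m) m / real (n - m) ^ s)" for n
  proof -
    have "real n * W (Suc s) n = (\<Sum>m<n. \<Sum>K\<in>partitions_of m.
        cycle_weight K * cycle_weight (add_mset (n - m) K) ^ s)"
      unfolding W power_Suc by (rule sum_cycle_weight_add_part)
    also have "\<dots> = (\<Sum>m<n. damped_W s (n - m) m / real (n - m) ^ s)"
      by (simp add: damped_W_def cycle_weight_add_mset power_divide power_mult_distrib
          sum_divide_distrib mult.commute del: of_nat_Suc)
    finally show ?thesis .
  qed
qed (rule assms)

theorem theoremA1:
  fixes r :: nat
  assumes "r \<ge> 2"
  shows "summable (W r) \<and>
         W r \<sim>[at_top] (\<lambda>n. (\<Sum>m. W r m) / real n ^ r)"
proof
  obtain s where r: "r = Suc s" and "s > 0" using assms by (cases r) auto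
  then interpret size_biased_recurrence s "W r" "damped_W s"
    using size_biased_recurrence_W by simp
  let ?A = "\<Sum>m. W r m"
  show "summable (W r)" by (rule summable_a)
  have "(\<Sum>m<1. W r m) \<le> ?A" by (intro sum_le_suminf summable_a) (auto simp: a_nonneg)
  then have A: "?A > 0" by (simp add: W_def)
  have "(\<lambda>n. real n ^ r * W r n / ?A) \<longlonglongrightarrow> ?A / ?A"
    using A scaled_tendsto unfolding r by (intro tendsto_intros) auto
  then show "W r \<sim>[at_top] (\<lambda>n. ?A / real n ^ r)"
    using A by (intro asymp_equivI') (simp add: field_simps)
qed

end
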